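(* Let $V$ and $Q$ be real Hilbert spaces, and let $A: V \to V'$, $B: V \to Q'$, $C: Q \to Q'$ be linear operators such that the following hold. (i) $\langle Au, v\rangle$ is an inner product on $V$; write $\|v\|_A^2 := \langle Av, v\rangle$ for $v \in V$. (ii) There are a semi-norm $|\cdot|_B$ on $Q$ and two constants $\zeta_0, \zeta_\infty \in \mathbb{R}$ such that $$0 < \zeta_0 \le \sup_{v \in V} \frac{\langle Bv, p\rangle}{\|v\|_A\, |p|_B} \le \zeta_\infty < \infty \qquad \text{for all } p \in Q .$$ (iii) $\langle Cp, q\rangle$ is a semi-inner product on $Q$; write $|q|_C^2 := \langle Cq, q\rangle$ for $q \in Q$. (iv) The expression $|||(u,p)|||^2 := \|u\|_A^2 + |p|_B^2 + |p|_C^2$ defines a proper norm, and $V \times Q$ is the (Hilbert) space of pairs for which this norm is finite. Then the saddle point problem: given $(f,g) \in (V\times Q)'$, find $(u,p) \in V \times Q$ such that $$\mathcal{A}(u,p) = (f,g), \qquad \mathcal{A} := \begin{bmatrix} A & B' \\ B & -C \end{bmatrix},$$ is well-posed in $V \times Q$ endowed with the norm $|||\cdot|||$.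
   Context: $X'$ denotes the dual of a Hilbert space $X$ and $\langle\cdot,\cdot\rangle$ the duality pairing; $B': Q \to V'$ is the adjoint, $\langle B'p, v\rangle = \langle Bv, p\rangle$. Thus $\langle \mathcal{A}(u,p),(v,q)\rangle = \langle Au,v\rangle + \langle Bv,p\rangle + \langle Bu,q\rangle - \langle Cp,q\rangle$. A semi-inner product is a symmetric positive semi-definite bilinear form. Condition (ii) is understood in the form $\zeta_0 |p|_B \le \sup_{0\ne v\in V} \langle Bv,p\rangle/\|v\|_A \le \zeta_\infty |p|_B$ for all $p\in Q$ (so that elements with $|p|_B = 0$ are covered). The topologies of $V$ and $Q$ are those given by the norms $\|\cdot\|_A$ and $(|\cdot|_B^2+|\cdot|_C^2)^{1/2}$, for which they are complete. Well-posed means: $\mathcal{A}: V\times Q \to (V\times Q)'$ is bounded, and for every $(f,g)\in (V\times Q)'$ there is a unique solution $(u,p)\in V\times Q$, which satisfies $|||(u,p)||| \le c\,\|(f,g)\|_{(V\times Q)'}$ with $c$ independent of $(f,g)$. *)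

theory Defs
  imports "HOL-Analysis.Analysis"
begin

text \<open>
  Hilbert spaces are types of class \<open>{real_inner, complete_space}\<close>, and \<open>X'\<close> is the type
  \<open>'x \<Rightarrow>\<^sub>L real\<close>.  The norm of the type class serves only to fix the topology of the space; the
  norms of the saddle point problem are separate functions, which generate that topology.
\<close>

definition semi_inner_product :: "('a::real_vector \<Rightarrow> 'a \<Rightarrow> real) \<Rightarrow> bool" where
  "semi_inner_product a \<longleftrightarrow> bilinear a \<and> (\<forall>x y. a x y = a y x) \<and> (\<forall>x. 0 \<le> a x x)"

definition inner_product :: "('a::real_vector \<Rightarrow> 'a \<Rightarrow> real) \<Rightarrow> bool" where
  "inner_product a \<longleftrightarrow> semi_inner_product a \<and> (\<forall>x. a x x = 0 \<longrightarrow> x = 0)"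

definition is_seminorm :: "('a::real_vector \<Rightarrow> real) \<Rightarrow> bool" where
  "is_seminorm n \<longleftrightarrow>
     (\<forall>x. 0 \<le> n x) \<and> (\<forall>r x. n (r *\<^sub>R x) = \<bar>r\<bar> * n x) \<and> (\<forall>x y. n (x + y) \<le> n x + n y)"

definition is_norm :: "('a::real_vector \<Rightarrow> real) \<Rightarrow> bool" where
  "is_norm n \<longleftrightarrow> is_seminorm n \<and> (\<forall>x. n x = 0 \<longrightarrow> x = 0)"

definition generates_topology :: "('a::real_normed_vector \<Rightarrow> real) \<Rightarrow> bool" where
  "generates_topology n \<longleftrightarrow> Metric_space.mtopology UNIV (\<lambda>x y. n (x - y)) = euclidean"

definition complete_wrt :: "('a::real_vector \<Rightarrow> real) \<Rightarrow> bool" where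
  "complete_wrt n \<longleftrightarrow> Metric_space.mcomplete UNIV (\<lambda>x y. n (x - y))"

definition form_norm :: "('a::real_normed_vector \<Rightarrow> ('a \<Rightarrow>\<^sub>L real)) \<Rightarrow> 'a \<Rightarrow> real" where
  "form_norm A u = sqrt (A u u)"

text \<open>
  The supremum of \<open>\<langle>Bv,p\<rangle> / \<parallel>v\<parallel>\<^sub>A\<close> over \<open>v \<noteq> 0\<close>.  It is nonnegative as soon as there is some
  \<open>v \<noteq> 0\<close> (replace \<open>v\<close> by \<open>-v\<close>), so the inserted \<open>0\<close> matters only for \<open>V = {0}\<close>, where it makes
  the supremum of the empty set \<open>0\<close> instead of \<open>-\<infinity>\<close>.
\<close>
definition sup_quotient ::
  "('v::real_normed_vector \<Rightarrow> ('v \<Rightarrow>\<^sub>L real)) \<Rightarrow> ('v \<Rightarrow> ('q::real_normed_vector \<Rightarrow>\<^sub>L real)) \<Rightarrow> 'q \<Rightarrow> ereal"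
  where "sup_quotient A B p = Sup (insert 0 {ereal (B v p / form_norm A v) | v. v \<noteq> 0})"

definition Q_norm :: "('q::real_normed_vector \<Rightarrow> real) \<Rightarrow> ('q \<Rightarrow> ('q \<Rightarrow>\<^sub>L real)) \<Rightarrow> 'q \<Rightarrow> real" where
  "Q_norm nB C p = sqrt ((nB p)\<^sup>2 + (form_norm C p)\<^sup>2)"

definition triple_norm ::
  "('v::real_normed_vector \<Rightarrow> ('v \<Rightarrow>\<^sub>L real)) \<Rightarrow> ('q::real_normed_vector \<Rightarrow> real) \<Rightarrow>
   ('q \<Rightarrow> ('q \<Rightarrow>\<^sub>L real)) \<Rightarrow> 'v \<times> 'q \<Rightarrow> real" where
  "triple_norm A nB C =
     (\<lambda>(u, p). sqrt ((form_norm A u)\<^sup>2 + (nB p)\<^sup>2 + (form_norm C p)\<^sup>2))"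

text \<open>The second summand is \<open>\<langle>B'p,v\<rangle>\<close>, written out by the definition of the adjoint.\<close>
definition saddle_op ::
  "('v::real_normed_vector \<Rightarrow> ('v \<Rightarrow>\<^sub>L real)) \<Rightarrow> ('v \<Rightarrow> ('q::real_normed_vector \<Rightarrow>\<^sub>L real)) \<Rightarrow>
   ('q \<Rightarrow> ('q \<Rightarrow>\<^sub>L real)) \<Rightarrow> 'v \<times> 'q \<Rightarrow> 'v \<times> 'q \<Rightarrow> real" where
  "saddle_op A B C = (\<lambda>(u, p) (v, q). (A u v + B v p) + (B u q - C p q))"

text \<open>
  The dual of a space endowed with the norm \<open>n\<close>.  As in \<^const>\<open>onorm\<close>, the supremum in the dual norm
  may run over all \<open>x\<close>, because \<open>x = 0\<close> contributes \<open>0 / 0 = 0\<close>.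
\<close>
definition dual_space :: "('a::real_vector \<Rightarrow> real) \<Rightarrow> ('a \<Rightarrow> real) set" where
  "dual_space n = {F. linear F \<and> (\<exists>c. \<forall>x. \<bar>F x\<bar> \<le> c * n x)}"

definition dual_norm :: "('a::real_vector \<Rightarrow> real) \<Rightarrow> ('a \<Rightarrow> real) \<Rightarrow> real" where
  "dual_norm n F = (SUP x. \<bar>F x\<bar> / n x)"

definition well_posed :: "('a::real_vector \<Rightarrow> real) \<Rightarrow> ('a \<Rightarrow> 'a \<Rightarrow> real) \<Rightarrow> bool" where
  "well_posed n T \<longleftrightarrow>
     (\<forall>x. T x \<in> dual_space n) \<and>
     (\<exists>c. \<forall>x. dual_norm n (T x) \<le> c * n x) \<and>
     (\<forall>F \<in> dual_space n. \<exists>!x. T x = F) \<and>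
     (\<exists>c. \<forall>F \<in> dual_space n. \<forall>x. T x = F \<longrightarrow> n x \<le> c * dual_norm n F)"

end

theory Submission
  imports Defs
begin

text \<open>
  The idea is to eliminate \<open>u\<close>.  The bound \<open>\<zeta>\<^sub>\<infinity>\<close> makes \<open>v \<mapsto> \<langle>Bv,p\<rangle>\<close> continuous for \<open>\<parallel>\<cdot>\<parallel>\<^sub>A\<close>, so by
  Riesz there is \<open>Rp \<in> V\<close> with \<open>\<langle>A Rp, v\<rangle> = \<langle>Bv,p\<rangle>\<close>, that is \<open>R = A\<^sup>-\<^sup>1B'\<close>.  The supremum in
  condition (ii) is \<open>\<parallel>Rp\<parallel>\<^sub>A\<close>, so that condition says \<open>\<zeta>\<^sub>0 |p|\<^sub>B \<le> \<parallel>Rp\<parallel>\<^sub>A \<le> \<zeta>\<^sub>\<infinity> |p|\<^sub>B\<close>.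
  Although \<open>|\<cdot>|\<^sub>B\<close> itself need not come from a bilinear form, it is thus equivalent to a seminorm
  that does.

  Existence.  Writing \<open>f = Aw\<close>, the first equation reads \<open>u = w - Rp\<close>, and the second becomes
  \<open>s(p,q) = \<langle>Aw,Rq\<rangle> - \<langle>g,q\<rangle>\<close> with the Schur complement \<open>s(p,q) = \<langle>A Rp, Rq\<rangle> + \<langle>Cp,q\<rangle>\<close>.  By the
  equivalence of seminorms, \<open>s(p,p)\<close> is equivalent to \<open>|p|\<^sub>B\<^sup>2 + |p|\<^sub>C\<^sup>2\<close>
  (\<open>schur_ge\<close>, \<open>schur_le\<close>), for which \<open>Q\<close> is complete; so a symmetric Lax-Milgram theorem
  (\<open>symmetric_Lax_Milgram\<close>) gives \<open>p\<close>.

  Uniqueness and stability.  Testing with \<open>(u + Rp, -2p)\<close> cancels every mixed term: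
  \<open>\<langle>\<A>(u,p),(u + Rp,-2p)\<rangle> = \<parallel>u\<parallel>\<^sub>A\<^sup>2 + \<parallel>Rp\<parallel>\<^sub>A\<^sup>2 + 2|p|\<^sub>C\<^sup>2\<close>.  The right-hand side
  dominates \<open>|||(u,p)|||\<^sup>2\<close>, and the test function is bounded by a multiple of \<open>|||(u,p)|||\<close>
  (\<open>T_inf_sup\<close>).
\<close>

section \<open>Seminorms of positive semi-definite forms\<close>

definition energy_norm :: "('a \<Rightarrow> 'a \<Rightarrow> real) \<Rightarrow> 'a \<Rightarrow> real" where
  "energy_norm a x = sqrt (a x x)"

lemma semi_inner_productD:
  assumes "semi_inner_product a"
  shows "bilinear a" "a x y = a y x" "0 \<le> a x x"
  using assms by (auto simp: semi_inner_product_def)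

lemma energy_norm_nonneg: "semi_inner_product a \<Longrightarrow> 0 \<le> energy_norm a x"
  by (simp add: energy_norm_def semi_inner_product_def)

lemma energy_norm_square: "semi_inner_product a \<Longrightarrow> (energy_norm a x)\<^sup>2 = a x x"
  by (simp add: energy_norm_def semi_inner_product_def)

lemmas bilinear_expand = bilinear_ladd bilinear_radd bilinear_lsub bilinear_rsub
  bilinear_lmul bilinear_rmul bilinear_lneg bilinear_rneg

text \<open>
  The quadratic \<open>t \<mapsto> a(x + t y, x + t y)\<close> is nonnegative.  Since \<open>a\<close> need not be definite,
  \<open>a(y,y) = 0\<close> can occur with \<open>y \<noteq> 0\<close>; then the quadratic is affine, which forces \<open>a(x,y) = 0\<close>.
\<close>
lemma form_Cauchy_Schwarz:
  assumes "semi_inner_product a"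
  shows "\<bar>a x y\<bar> \<le> energy_norm a x * energy_norm a y"
proof -
  note sip = semi_inner_productD[OF assms]
  note expand = bilinear_expand[OF sip(1)]
  have nonneg: "0 \<le> a x x + 2 * (t * a x y) + t\<^sup>2 * a y y" for t
  proof -
    have "0 \<le> a (x + t *\<^sub>R y) (x + t *\<^sub>R y)" by (rule sip)
    also have "\<dots> = a x x + 2 * (t * a x y) + t\<^sup>2 * a y y"
      using sip(2)[of y x] by (simp only: expand) (simp add: algebra_simps power2_eq_square)
    finally show ?thesis .
  qed
  have "(a x y)\<^sup>2 \<le> a x x * a y y"
  proof (cases "a y y = 0")
    case True
    have "a x y = 0"
    proof (rule ccontr)
      assume "a x y \<noteq> 0"
      then show False
        using nonneg[of "- (a x x + 1) / a x y"] True sip(3)[of x] by simp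
    qed
    then show ?thesis using True by simp
  next
    case False
    then have pos: "a y y > 0" using sip(3)[of y] by simp
    have "0 \<le> a x x - (a x y)\<^sup>2 / a y y"
      using nonneg[of "- a x y / a y y"] pos by (simp add: field_simps power2_eq_square)
    then show ?thesis using pos by (simp add: field_simps)
  qed
  then have "sqrt ((a x y)\<^sup>2) \<le> sqrt (a x x * a y y)" by (rule real_sqrt_le_mono)
  then show ?thesis by (simp add: energy_norm_def real_sqrt_mult)
qed

lemma is_seminorm_energy_norm:
  assumes "semi_inner_product a"
  shows "is_seminorm (energy_norm a)"
  unfolding is_seminorm_def
proof (intro conjI allI)
  note sip = semi_inner_productD[OF assms]
  note expand = bilinear_expand[OF sip(1)]
  fix x y and r :: real
  show "0 \<le> energy_norm a x" by (rule energy_norm_nonneg[OF assms])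
  show "energy_norm a (r *\<^sub>R x) = \<bar>r\<bar> * energy_norm a x"
    unfolding energy_norm_def expand
    by (simp add: real_sqrt_mult flip: mult.assoc)
  have "a x y \<le> energy_norm a x * energy_norm a y"
    using form_Cauchy_Schwarz[OF assms, of x y] by simp
  then have "(energy_norm a (x + y))\<^sup>2 \<le> (energy_norm a x + energy_norm a y)\<^sup>2"
    using sip(2)[of y x] by (simp add: power2_sum energy_norm_square[OF assms] expand)
  then show "energy_norm a (x + y) \<le> energy_norm a x + energy_norm a y"
    by (rule power2_le_imp_le) (simp add: energy_norm_nonneg[OF assms])
qed

lemma is_norm_energy_norm:
  assumes "inner_product a"
  shows "is_norm (energy_norm a)"
  using assms is_seminorm_energy_norm[of a]
  by (auto simp: inner_product_def is_norm_def energy_norm_def)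

lemma is_seminormD:
  assumes "is_seminorm n"
  shows "0 \<le> n x" "n (r *\<^sub>R x) = \<bar>r\<bar> * n x" "n (x + y) \<le> n x + n y" "n (- x) = n x" "n 0 = 0"
proof -
  show *: "0 \<le> n x" "n (r *\<^sub>R x) = \<bar>r\<bar> * n x" "n (x + y) \<le> n x + n y" for x y r
    using assms by (auto simp: is_seminorm_def)
  show "n (- x) = n x" using *(2)[of "-1" x] by simp
  show "n 0 = 0" using *(2)[of 0 0] by simp
qed

section \<open>Completeness and the Riesz representation\<close>

lemma Metric_space_norm:
  assumes "is_norm n"
  shows "Metric_space UNIV (\<lambda>x y. n (x - y))"
proof -
  have s: "is_seminorm n" and d: "n x = 0 \<Longrightarrow> x = 0" for x
    using assms by (auto simp: is_norm_def)
  show ?thesis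
  proof
    show "0 \<le> n (x - y)" for x y by (rule is_seminormD(1)[OF s])
    show "n (x - y) = n (y - x)" for x y using is_seminormD(4)[OF s, of "x - y"] by simp
    show "(n (x - y) = 0) = (x = y)" for x y
      using d[of "x - y"] is_seminormD(5)[OF s] by auto
    show "n (x - z) \<le> n (x - y) + n (y - z)" for x y z
      using is_seminormD(3)[OF s, of "x - y" "y - z"] by simp
  qed
qed

text \<open>
  This eliminates the metric spaces in terms of which completeness is defined; what
  remains are limits of real sequences.
\<close>
lemma complete_wrtD:
  assumes "is_norm n" "complete_wrt n"
    and "\<And>e. e > 0 \<Longrightarrow> \<exists>N. \<forall>j\<ge>N. \<forall>k\<ge>N. n (\<sigma> j - \<sigma> k) < e"
  obtains w where "(\<lambda>k. n (\<sigma> k - w)) \<longlonglongrightarrow> 0"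
proof -
  interpret Metric_space UNIV "\<lambda>x y. n (x - y)" by (rule Metric_space_norm) fact
  have "MCauchy \<sigma>" using assms(3) by (simp add: MCauchy_def)
  then obtain w where "limitin mtopology \<sigma> w sequentially"
    using assms(2) by (auto simp: complete_wrt_def mcomplete_def)
  then have "\<forall>e>0. \<exists>N. \<forall>k\<ge>N. n (\<sigma> k - w) < e"
    by (simp add: limit_metric_sequentially)
  then have "(\<lambda>k. n (\<sigma> k - w)) \<longlonglongrightarrow> 0"
    by (simp add: LIMSEQ_iff nonneg)
  then show ?thesis by (rule that)
qed

text \<open>
  A solution minimises the energy \<open>J v = a(v,v) - 2 F v\<close>.  Coercivity bounds \<open>J\<close> below, and the
  parallelogram law makes each minimising sequence Cauchy.  Minimality of the limit itself is never
  shown: a near-minimiser already satisfies \<open>a(x,v) = F v\<close> up to a small residual, and this passes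
  to the limit by continuity of the form.  The norm is kept separate from the form because the
  Schur complement below is only equivalent to the square of the norm for which completeness is
  known.
\<close>
theorem symmetric_Lax_Milgram:
  assumes a: "semi_inner_product a"
    and n: "is_norm n" "complete_wrt n"
    and coercive: "0 < \<alpha>" "\<And>x. \<alpha> * (n x)\<^sup>2 \<le> a x x"
    and bounded: "\<And>x. a x x \<le> \<beta> * (n x)\<^sup>2"
    and F: "linear F" "\<And>x. \<bar>F x\<bar> \<le> \<gamma> * n x"
  shows "\<exists>w. \<forall>v. a w v = F v"
proof -
  note sip = semi_inner_productD[OF a]
  note expand = bilinear_expand[OF sip(1)]
  note Fexpand = linear_add[OF F(1)] linear_diff[OF F(1)] linear_scale[OF F(1)]
  define J where "J v = a v v - 2 * F v" for v
  define m where "m = Inf (range J)"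
  have "- \<gamma>\<^sup>2 / \<alpha> \<le> J v" for v
  proof -
    have "0 \<le> (\<alpha> * n v - \<gamma>)\<^sup>2" by simp
    then have "- \<gamma>\<^sup>2 \<le> \<alpha> * (\<alpha> * (n v)\<^sup>2 - 2 * \<gamma> * n v)"
      by (simp add: power2_eq_square algebra_simps)
    also have "\<dots> \<le> \<alpha> * J v"
      unfolding J_def using coercive(1) F(2)[of v] coercive(2)[of v]
      by (intro mult_left_mono) linarith+
    finally show ?thesis using coercive(1) by (simp add: field_simps)
  qed
  then have bdd: "bdd_below (range J)" by (meson bdd_belowI2)
  have m_le: "m \<le> J v" for v unfolding m_def using bdd by (rule cInf_lower[rotated]) simp
  have "\<exists>v. J v < m + 1 / real (Suc k)" for k
    using cInf_lessD[of "range J" "m + 1 / real (Suc k)"] by (auto simp: m_def)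
  then obtain \<sigma> where \<sigma>: "\<And>k. J (\<sigma> k) < m + 1 / real (Suc k)" by metis
  have parallelogram: "\<alpha> * (n (x - y))\<^sup>2 \<le> 2 * ((J x - m) + (J y - m))" for x y
  proof -
    have "a (x - y) (x - y) / 2 = J x + J y - 2 * J ((1/2) *\<^sub>R (x + y))"
      using sip(2)[of y x] by (simp only: J_def expand Fexpand) (simp add: field_simps)
    with m_le[of "(1/2) *\<^sub>R (x + y)"] coercive(2)[of "x - y"] show ?thesis by simp
  qed
  obtain w where w: "(\<lambda>k. n (\<sigma> k - w)) \<longlonglongrightarrow> 0"
  proof (rule complete_wrtD[OF n])
    fix e :: real assume e: "e > 0"
    \<comment> \<open>Beyond \<open>N\<close> each energy exceeds \<open>m\<close> by less than \<open>1 / N\<close>, so the parallelogram estimate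
      gives \<open>\<alpha> n(x - y)\<^sup>2 < 4 / N\<close>.\<close>
    then obtain N where N: "4 / (\<alpha> * e\<^sup>2) < real N" using reals_Archimedean2 by blast
    have "n (\<sigma> j - \<sigma> k) < e" if "j \<ge> N" "k \<ge> N" for j k
    proof -
      have pos: "0 < \<alpha> * e\<^sup>2" using e coercive(1) by simp
      have "0 < 4 / (\<alpha> * e\<^sup>2)" using pos by simp
      then have N0: "0 < real N" using N by linarith
      have le: "1 / real (Suc i) \<le> 1 / real N" if "N \<le> i" for i
        using that N0 by (intro divide_left_mono) auto
      have "\<alpha> * (n (\<sigma> j - \<sigma> k))\<^sup>2 \<le> 2 * ((J (\<sigma> j) - m) + (J (\<sigma> k) - m))"
        by (rule parallelogram)
      also have "\<dots> < 4 / real N" using \<sigma>[of j] \<sigma>[of k] le[OF that(1)] le[OF that(2)] by simp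
      also have "\<dots> < \<alpha> * e\<^sup>2" using N N0 pos by (simp add: field_simps)
      finally have "(n (\<sigma> j - \<sigma> k))\<^sup>2 < e\<^sup>2" using coercive(1) by simp
      then show ?thesis using e by (simp add: power_less_imp_less_base)
    qed
    then show "\<exists>N. \<forall>j\<ge>N. \<forall>k\<ge>N. n (\<sigma> j - \<sigma> k) < e" by blast
  qed (rule that)
  have "a w v = F v" for v
  proof -
    have residual: "(a (\<sigma> k) v - F v)\<^sup>2 \<le> (a v v + 1) * (1 / real (Suc k))" for k
    proof -
      let ?d = "a (\<sigma> k) v - F v" and ?s = "a v v + 1"
      \<comment> \<open>This is the minimiser of \<open>2 t d + t\<^sup>2 s\<close>; the summand \<open>1\<close> in \<open>s\<close> avoids a division by \<open>0\<close>
        for \<open>v = 0\<close>.\<close>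
      let ?t = "- ?d / ?s"
      have s: "0 < ?s" "a v v \<le> ?s" using sip(3)[of v] by auto
      have "J (\<sigma> k + t *\<^sub>R v) = J (\<sigma> k) + 2 * t * ?d + t\<^sup>2 * a v v" for t
        using sip(2)[of v "\<sigma> k"]
        by (simp only: J_def expand Fexpand) (simp add: algebra_simps power2_eq_square)
      from this[of ?t]
      have "J (\<sigma> k + ?t *\<^sub>R v) = J (\<sigma> k) + 2 * ?t * ?d + ?t\<^sup>2 * a v v" .
      moreover have "?t\<^sup>2 * a v v \<le> ?t\<^sup>2 * ?s" using s by (intro mult_left_mono) auto
      moreover have "2 * ?t * ?d + ?t\<^sup>2 * ?s = - (?d\<^sup>2 / ?s)"
        using s(1) by (simp add: divide_simps) (simp add: algebra_simps power2_eq_square)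
      ultimately have "?d\<^sup>2 / ?s \<le> 1 / real (Suc k)"
        using m_le[of "\<sigma> k + ?t *\<^sub>R v"] \<sigma>[of k] by linarith
      then show ?thesis using s(1) by (simp add: pos_divide_le_eq mult.commute)
    qed
    have "(\<lambda>k. (a v v + 1) * (1 / real (Suc k))) \<longlonglongrightarrow> 0"
      using LIMSEQ_inverse_real_of_nat by (intro tendsto_mult_right_zero) (simp add: inverse_eq_divide)
    then have "(\<lambda>k. (a (\<sigma> k) v - F v)\<^sup>2) \<longlonglongrightarrow> 0"
      by (rule tendsto_sandwich[OF _ _ tendsto_const, rotated 2]) (use residual in auto)
    then have 1: "(\<lambda>k. a (\<sigma> k) v - F v) \<longlonglongrightarrow> 0" by simp
    have "norm (a (\<sigma> k - w) v) \<le> (sqrt \<beta> * energy_norm a v) * n (\<sigma> k - w)" for k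
    proof -
      have "energy_norm a (\<sigma> k - w) \<le> sqrt \<beta> * n (\<sigma> k - w)"
        using real_sqrt_le_mono[OF bounded[of "\<sigma> k - w"]] n(1)
        by (simp add: energy_norm_def real_sqrt_mult is_norm_def is_seminorm_def)
      then have "energy_norm a (\<sigma> k - w) * energy_norm a v
          \<le> sqrt \<beta> * n (\<sigma> k - w) * energy_norm a v"
        by (rule mult_right_mono) (rule energy_norm_nonneg[OF a])
      with form_Cauchy_Schwarz[OF a, of "\<sigma> k - w" v] show ?thesis by (simp add: mult_ac)
    qed
    then have "\<forall>\<^sub>F k in sequentially. norm (a (\<sigma> k - w) v) \<le> (sqrt \<beta> * energy_norm a v) * n (\<sigma> k - w)"
      by simp
    moreover have "(\<lambda>k. (sqrt \<beta> * energy_norm a v) * n (\<sigma> k - w)) \<longlonglongrightarrow> 0"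
      by (intro tendsto_mult_right_zero w)
    ultimately have "(\<lambda>k. a (\<sigma> k - w) v) \<longlonglongrightarrow> 0"
      by (rule Lim_null_comparison)
    from tendsto_diff[OF 1 this] have "(\<lambda>k. a w v - F v) \<longlonglongrightarrow> 0" by (simp add: expand)
    then show ?thesis by (simp add: LIMSEQ_const_iff)
  qed
  then show ?thesis by blast
qed

lemma Riesz_representation:
  assumes "inner_product a" "complete_wrt (energy_norm a)"
    and "linear F" "\<And>x. \<bar>F x\<bar> \<le> \<gamma> * energy_norm a x"
  shows "\<exists>!w. \<forall>v. a w v = F v"
proof (rule ex_ex1I)
  have a: "semi_inner_product a" using assms(1) by (simp add: inner_product_def)
  show "\<exists>w. \<forall>v. a w v = F v"
    using symmetric_Lax_Milgram[OF a is_norm_energy_norm[OF assms(1)] assms(2), of 1 1 F \<gamma>] assms(3,4)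
    by (simp add: energy_norm_square[OF a])
  fix w w' assume "\<forall>v. a w v = F v" "\<forall>v. a w' v = F v"
  then have "a (w - w') (w - w') = 0"
    by (simp add: bilinear_lsub[OF semi_inner_productD(1)[OF a]])
  then have "w - w' = 0" using assms(1) unfolding inner_product_def by blast
  then show "w = w'" by simp
qed

section \<open>The dual norm\<close>

lemma dual_norm_upper:
  assumes "is_norm n" "F \<in> dual_space n"
  shows "\<bar>F x\<bar> / n x \<le> dual_norm n F"
proof -
  have nn: "0 \<le> n x" for x using assms(1) by (simp add: is_norm_def is_seminorm_def)
  obtain c where c: "\<And>x. \<bar>F x\<bar> \<le> c * n x" using assms(2) by (auto simp: dual_space_def)
  have "\<bar>F x\<bar> / n x \<le> max c 0" for x
  proof (cases "n x = 0")
    case False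
    then have "\<bar>F x\<bar> / n x \<le> c" using c[of x] nn[of x] by (simp add: pos_divide_le_eq)
    then show ?thesis by simp
  qed simp
  then have "bdd_above (range (\<lambda>x. \<bar>F x\<bar> / n x))" by (meson bdd_aboveI2)
  then show ?thesis
    unfolding dual_norm_def by (rule cSUP_upper[OF UNIV_I])
qed

lemma dual_norm_nonneg:
  assumes "is_norm n" "F \<in> dual_space n"
  shows "0 \<le> dual_norm n F"
  using dual_norm_upper[OF assms, of 0] is_seminormD(5)[of n] assms(1) by (simp add: is_norm_def)

lemma dual_norm_bound:
  assumes "is_norm n" "F \<in> dual_space n"
  shows "\<bar>F x\<bar> \<le> dual_norm n F * n x"
proof (cases "n x = 0")
  case True
  then have "x = 0" using assms(1) by (simp add: is_norm_def)
  then have "F x = 0" using assms(2) by (simp add: dual_space_def linear_0)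
  then show ?thesis using True by simp
next
  case False
  moreover have "0 \<le> n x" using assms(1) by (simp add: is_norm_def is_seminorm_def)
  ultimately show ?thesis using dual_norm_upper[OF assms, of x] by (simp add: pos_divide_le_eq)
qed

lemma dual_norm_le:
  assumes "is_norm n" "0 \<le> c" "\<And>x. \<bar>F x\<bar> \<le> c * n x"
  shows "dual_norm n F \<le> c"
  unfolding dual_norm_def
proof (rule cSUP_least)
  fix x
  have "0 \<le> n x" using assms(1) by (simp add: is_norm_def is_seminorm_def)
  then show "\<bar>F x\<bar> / n x \<le> c"
    using assms(2) assms(3)[of x] by (cases "n x = 0") (auto simp: pos_divide_le_eq)
qed simp

section \<open>Saddle point problems\<close>

text \<open>
  The setting in terms of real-valued forms.  The two-sided bound on the supremum is split into
  its two uses: the upper half is continuity of \<open>b\<close>, the lower half says that each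
  constant \<open>t \<ge> 0\<close> with \<open>b(v,p) \<le> t \<parallel>v\<parallel>\<^sub>A\<close> for all \<open>v\<close> is at least \<open>\<zeta>\<^sub>0 |p|\<^sub>B\<close>.
\<close>
locale saddle_point =
  fixes a :: "'v::real_vector \<Rightarrow> 'v \<Rightarrow> real"
    and b :: "'v \<Rightarrow> 'q::real_vector \<Rightarrow> real"
    and c :: "'q \<Rightarrow> 'q \<Rightarrow> real"
    and nB :: "'q \<Rightarrow> real"
    and \<zeta>0 \<zeta>1 :: real
    and n :: "'v \<times> 'q \<Rightarrow> real"
    and T :: "'v \<times> 'q \<Rightarrow> 'v \<times> 'q \<Rightarrow> real"
  defines "n \<equiv> \<lambda>(u, p). sqrt (a u u + (nB p)\<^sup>2 + c p p)"
    and "T \<equiv> \<lambda>(u, p) (v, q). a u v + b v p + b u q - c p q"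
  assumes a: "inner_product a"
    and b: "bilinear b"
    and c: "semi_inner_product c"
    and nB: "is_seminorm nB"
    and V_complete: "complete_wrt (energy_norm a)"
    and Q_complete: "complete_wrt (\<lambda>p. n (0, p))"
    and n: "is_norm n"
    and \<zeta>0: "0 < \<zeta>0"
    and b_bounded: "\<And>v p. \<bar>b v p\<bar> \<le> \<zeta>1 * nB p * energy_norm a v"
    and inf_sup: "\<And>p t. 0 \<le> t \<Longrightarrow> (\<And>v. b v p \<le> t * energy_norm a v) \<Longrightarrow> \<zeta>0 * nB p \<le> t"
begin

lemma a_semi: "semi_inner_product a"
  using a by (simp add: inner_product_def)

lemmas a_expand = bilinear_expand[OF semi_inner_productD(1)[OF a_semi]]
lemmas b_expand = bilinear_expand[OF b]
lemmas c_expand = bilinear_expand[OF semi_inner_productD(1)[OF c]]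

lemma nB_nonneg: "0 \<le> nB p"
  by (rule is_seminormD(1)[OF nB])

lemma n_nonneg: "0 \<le> n x"
  using n is_seminormD(1) by (auto simp: is_norm_def)

lemma n_square: "(n (u, p))\<^sup>2 = a u u + (nB p)\<^sup>2 + c p p"
  by (simp add: n_def semi_inner_productD[OF a_semi] semi_inner_productD[OF c])

lemma n_V: "n (u, 0) = energy_norm a u"
  by (simp add: n_def energy_norm_def is_seminormD[OF nB] bilinear_lzero[OF semi_inner_productD(1)[OF c]])

lemma components_le_n:
  shows "energy_norm a u \<le> n (u, p)" "nB p \<le> n (u, p)" "energy_norm c p \<le> n (u, p)"
proof -
  note nonneg = semi_inner_productD(3)[OF a_semi] semi_inner_productD(3)[OF c]
  show "energy_norm a u \<le> n (u, p)" "energy_norm c p \<le> n (u, p)"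
    using nonneg by (auto simp: energy_norm_def n_def)
  show "nB p \<le> n (u, p)"
    using nonneg by (auto simp: n_def intro!: real_le_rsqrt)
qed

lemma linear_T: "linear (T x)"
  by (cases x, rule linearI)
     (auto simp: T_def a_expand b_expand c_expand algebra_simps)

lemma T_diff: "T (x - y) z = T x z - T y z"
  by (cases x, cases y, cases z) (auto simp: T_def a_expand b_expand c_expand algebra_simps)

lemma T_bounded: "\<bar>T x y\<bar> \<le> (2 + 2 * \<bar>\<zeta>1\<bar>) * n x * n y"
proof -
  obtain u p v q where xy: "x = (u, p)" "y = (v, q)" by (cases x, cases y)
  note le = components_le_n[where u = u and p = p] components_le_n[where u = v and p = q]
  note nonneg = n_nonneg nB_nonneg energy_norm_nonneg[OF a_semi] energy_norm_nonneg[OF c]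
  have "\<bar>b w r\<bar> \<le> \<bar>\<zeta>1\<bar> * (energy_norm a w * nB r)" for w r
  proof -
    have "\<zeta>1 * (energy_norm a w * nB r) \<le> \<bar>\<zeta>1\<bar> * (energy_norm a w * nB r)"
      by (intro mult_right_mono) (auto simp: nonneg)
    with b_bounded[of w r] show ?thesis by (simp add: mult_ac)
  qed
  moreover have "energy_norm a v * nB p \<le> n y * n x"
    unfolding xy by (intro mult_mono le nonneg)
  ultimately have 1: "\<bar>b v p\<bar> \<le> \<bar>\<zeta>1\<bar> * (n x * n y)"
    by (smt (verit) mult_left_mono abs_ge_zero mult.commute)
  have "\<bar>b u q\<bar> \<le> \<bar>\<zeta>1\<bar> * (energy_norm a u * nB q)" by fact
  also have "\<dots> \<le> \<bar>\<zeta>1\<bar> * (n x * n y)"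
    unfolding xy by (intro mult_left_mono mult_mono le nonneg) auto
  finally have 2: "\<bar>b u q\<bar> \<le> \<bar>\<zeta>1\<bar> * (n x * n y)" .
  have "\<bar>a u v\<bar> \<le> energy_norm a u * energy_norm a v" by (rule form_Cauchy_Schwarz[OF a_semi])
  also have "\<dots> \<le> n x * n y" unfolding xy by (intro mult_mono le nonneg)
  finally have 3: "\<bar>a u v\<bar> \<le> n x * n y" .
  have "\<bar>c p q\<bar> \<le> energy_norm c p * energy_norm c q" by (rule form_Cauchy_Schwarz[OF c])
  also have "\<dots> \<le> n x * n y" unfolding xy by (intro mult_mono le nonneg)
  finally have "\<bar>c p q\<bar> \<le> n x * n y" .
  with 1 2 3 have "\<bar>T x y\<bar> \<le> 2 * (n x * n y) + 2 * (\<bar>\<zeta>1\<bar> * (n x * n y))"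
    unfolding xy T_def by auto
  then show ?thesis by (simp add: algebra_simps)
qed

subsection \<open>The Schur complement\<close>

text \<open>The operator \<open>A\<^sup>-\<^sup>1B'\<close>.\<close>
definition R :: "'q \<Rightarrow> 'v" where
  "R p = (THE w. \<forall>v. a w v = b v p)"

lemma a_R: "a (R p) v = b v p"
proof -
  have "linear (\<lambda>v. b v p)" using b by (simp add: bilinear_def)
  from theI'[OF Riesz_representation[OF a V_complete this b_bounded]]
  show ?thesis unfolding R_def by blast
qed

lemma a_eqI:
  assumes "\<And>v. a x v = a y v"
  shows "x = y"
proof -
  have "a (x - y) (x - y) = 0" 
    by (simp add: assms bilinear_lsub[OF semi_inner_productD(1)[OF a_semi]])
  then have "x - y = 0" using a unfolding inner_product_def by blast
  then show ?thesis by simp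
qed

lemma linear_R: "linear R"
  by (rule linearI; rule a_eqI) (simp_all add: a_expand a_R b_expand)

text \<open>
  By Cauchy-Schwarz, \<open>\<parallel>Rp\<parallel>\<^sub>A\<close> is an admissible constant in the inf-sup condition.
\<close>
lemma energy_R_ge: "\<zeta>0 * nB p \<le> energy_norm a (R p)"
proof (rule inf_sup)
  show "0 \<le> energy_norm a (R p)" by (rule energy_norm_nonneg[OF a_semi])
  show "b v p \<le> energy_norm a (R p) * energy_norm a v" for v
    using form_Cauchy_Schwarz[OF a_semi, of "R p" v] by (simp add: a_R)
qed

text \<open>Continuity of \<open>b\<close> is applied to \<open>v = Rp\<close>, where \<open>b(v,p) = \<parallel>Rp\<parallel>\<^sub>A\<^sup>2\<close>.\<close>
lemma energy_R_le: "energy_norm a (R p) \<le> \<bar>\<zeta>1\<bar> * nB p"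
proof -
  let ?r = "energy_norm a (R p)"
  have r: "0 \<le> ?r" by (rule energy_norm_nonneg[OF a_semi])
  have "?r * ?r = b (R p) p" using energy_norm_square[OF a_semi, of "R p"]
    by (simp add: a_R power2_eq_square)
  also have "\<dots> \<le> \<zeta>1 * nB p * ?r" using b_bounded[of "R p" p] by simp
  finally have "?r \<le> \<zeta>1 * nB p \<or> ?r = 0" using r by (auto simp: mult_le_cancel_right)
  moreover have "\<zeta>1 * nB p \<le> \<bar>\<zeta>1\<bar> * nB p" by (intro mult_right_mono nB_nonneg) simp
  moreover have "0 \<le> \<bar>\<zeta>1\<bar> * nB p" by (simp add: nB_nonneg)
  ultimately show ?thesis by auto
qed

lemma R_square_bounds:
  "\<zeta>0\<^sup>2 * (nB p)\<^sup>2 \<le> a (R p) (R p)" "a (R p) (R p) \<le> \<zeta>1\<^sup>2 * (nB p)\<^sup>2"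
proof -
  note nonneg = nB_nonneg energy_norm_nonneg[OF a_semi]
  have "(\<zeta>0 * nB p)\<^sup>2 \<le> (energy_norm a (R p))\<^sup>2"
    using energy_R_ge \<zeta>0 nonneg by (intro power_mono) auto
  then show "\<zeta>0\<^sup>2 * (nB p)\<^sup>2 \<le> a (R p) (R p)"
    by (simp add: energy_norm_square[OF a_semi] power_mult_distrib)
  have "(energy_norm a (R p))\<^sup>2 \<le> (\<bar>\<zeta>1\<bar> * nB p)\<^sup>2"
    using energy_R_le nonneg by (intro power_mono) auto
  then show "a (R p) (R p) \<le> \<zeta>1\<^sup>2 * (nB p)\<^sup>2"
    by (simp add: energy_norm_square[OF a_semi] power_mult_distrib)
qed

text \<open>The form of \<open>BA\<^sup>-\<^sup>1B' + C\<close>, the negative of the usual Schur complement.\<close>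
definition schur :: "'q \<Rightarrow> 'q \<Rightarrow> real" where
  "schur p q = a (R p) (R q) + c p q"

lemma schur_semi: "semi_inner_product schur"
  unfolding semi_inner_product_def
proof (intro conjI allI)
  note R_expand = linear_add[OF linear_R] linear_scale[OF linear_R]
  show "bilinear schur"
    unfolding bilinear_def
    by (intro conjI allI linearI) (auto simp: schur_def a_expand c_expand R_expand algebra_simps)
  show "schur x y = schur y x" "0 \<le> schur x x" for x y
    using semi_inner_productD(2,3)[OF a_semi] semi_inner_productD(2,3)[OF c]
    by (auto simp: schur_def)
qed

lemma schur_ge: "min 1 (\<zeta>0\<^sup>2) * (n (0, p))\<^sup>2 \<le> schur p p"
proof -
  have "min 1 (\<zeta>0\<^sup>2) * (nB p)\<^sup>2 \<le> \<zeta>0\<^sup>2 * (nB p)\<^sup>2"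
    by (intro mult_right_mono) auto
  moreover have "min 1 (\<zeta>0\<^sup>2) * c p p \<le> 1 * c p p"
    by (intro mult_right_mono semi_inner_productD(3)[OF c]) auto
  ultimately show ?thesis
    using R_square_bounds(1)[of p]
    by (simp add: n_square schur_def distrib_left bilinear_lzero[OF semi_inner_productD(1)[OF a_semi]])
qed

lemma schur_le: "schur p p \<le> max 1 (\<zeta>1\<^sup>2) * (n (0, p))\<^sup>2"
proof -
  have "\<zeta>1\<^sup>2 * (nB p)\<^sup>2 \<le> max 1 (\<zeta>1\<^sup>2) * (nB p)\<^sup>2"
    by (intro mult_right_mono) auto
  moreover have "1 * c p p \<le> max 1 (\<zeta>1\<^sup>2) * c p p"
    by (intro mult_right_mono semi_inner_productD(3)[OF c]) auto
  ultimately show ?thesis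
    using R_square_bounds(2)[of p]
    by (simp add: n_square schur_def distrib_left bilinear_lzero[OF semi_inner_productD(1)[OF a_semi]])
qed

lemma is_norm_n_Q: "is_norm (\<lambda>p. n (0, p))"
proof -
  note s = n[unfolded is_norm_def, THEN conjunct1]
  have "n (0, r *\<^sub>R p) = \<bar>r\<bar> * n (0, p)" for r p
    using is_seminormD(2)[OF s, of r "(0, p)"] by simp
  moreover have "n (0, p + q) \<le> n (0, p) + n (0, q)" for p q
    using is_seminormD(3)[OF s, of "(0, p)" "(0, q)"] by simp
  moreover have "p = 0" if "n (0, p) = 0" for p
    using n that unfolding is_norm_def by (metis prod.inject zero_prod_def)
  ultimately show ?thesis by (simp add: is_norm_def is_seminorm_def n_nonneg)
qed

subsection \<open>Existence\<close>

text \<open>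
  Block elimination: with \<open>w\<close> representing the first component of \<open>F\<close>, the first equation gives
  \<open>u = w - Rp\<close>, and substituting this into the second leaves an equation for \<open>p\<close> alone.
\<close>
lemma solution_exists:
  assumes "F \<in> dual_space n"
  shows "\<exists>x. T x = F"
proof -
  have F: "linear F" and F_bound: "\<And>x. \<bar>F x\<bar> \<le> dual_norm n F * n x"
    using assms dual_norm_bound[OF n assms] by (auto simp: dual_space_def)
  have F_V: "linear (\<lambda>v. F (v, 0))"
    using linear_add[OF F, of "(x, 0)" "(y, 0)" for x y] linear_scale[OF F, of r "(x, 0)" for r x]
    by (intro linearI) simp_all
  have F_Q: "linear (\<lambda>q. F (0, q))"
    using linear_add[OF F, of "(0, x)" "(0, y)" for x y] linear_scale[OF F, of r "(0, x)" for r x]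
    by (intro linearI) simp_all
  obtain w where w: "\<And>v. a w v = F (v, 0)"
    using Riesz_representation[OF a V_complete F_V] F_bound[of "(_, 0)"] unfolding n_V by blast
  define G where "G q = a w (R q) - F (0, q)" for q
  have G: "linear G"
    unfolding G_def
    using linear_add[OF F_Q] linear_scale[OF F_Q]
    by (intro linearI)
       (simp_all add: linear_add[OF linear_R] linear_scale[OF linear_R] a_expand algebra_simps)
  have G_bound: "\<bar>G q\<bar> \<le> (energy_norm a w * \<bar>\<zeta>1\<bar> + dual_norm n F) * n (0, q)" for q
  proof -
    have "\<bar>a w (R q)\<bar> \<le> energy_norm a w * energy_norm a (R q)"
      by (rule form_Cauchy_Schwarz[OF a_semi])
    also have "energy_norm a (R q) \<le> \<bar>\<zeta>1\<bar> * n (0, q)"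
      using energy_R_le[of q] components_le_n(2)[of q 0]
      by (meson abs_ge_zero mult_left_mono order_trans)
    finally have "\<bar>a w (R q)\<bar> \<le> energy_norm a w * (\<bar>\<zeta>1\<bar> * n (0, q))"
      by (simp add: mult_left_mono energy_norm_nonneg[OF a_semi])
    with F_bound[of "(0, q)"] show ?thesis unfolding G_def by (simp add: algebra_simps)
  qed
  have "0 < min 1 (\<zeta>0\<^sup>2)" using \<zeta>0 by simp
  from symmetric_Lax_Milgram[OF schur_semi is_norm_n_Q Q_complete this schur_ge schur_le G G_bound]
  obtain p where p: "\<And>q. schur p q = G q" by auto
  have "T (w - R p, p) (v, q) = F (v, q)" for v q
  proof -
    have "b (w - R p) q = a w (R q) - a (R p) (R q)"
      using semi_inner_productD(2)[OF a_semi, of "R q" "w - R p"] by (simp add: a_expand flip: a_R)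
    then have "T (w - R p, p) (v, q) = a w v + (a w (R q) - schur p q)"
      by (simp add: T_def a_expand a_R schur_def)
    also have "\<dots> = F (v, 0) + F (0, q)" by (simp add: w p G_def)
    also have "\<dots> = F (v, q)" using linear_add[OF F, of "(v, 0)" "(0, q)"] by simp
    finally show ?thesis .
  qed
  then have "T (w - R p, p) = F" by (auto simp: fun_eq_iff)
  then show ?thesis ..
qed

subsection \<open>Stability and uniqueness\<close>

text \<open>
  The mixed terms are all multiples of \<open>a(u, Rp)\<close>.  The test function \<open>(u + Rp, q)\<close> produces
  \<open>2 a(u, Rp)\<close> from the first equation, hence the factor in \<open>q = -2p\<close>.
\<close>
lemma T_test_function: "T (u, p) (u + R p, - 2 *\<^sub>R p) = a u u + a (R p) (R p) + 2 * c p p"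
proof -
  have "b u p = a (R p) u" "a u (R p) = a (R p) u" "b (R p) p = a (R p) (R p)"
    using semi_inner_productD(2)[OF a_semi, of u "R p"] by (simp_all add: a_R)
  then show ?thesis by (simp add: T_def a_expand b_expand c_expand)
qed

text \<open>
  The test function \<open>y = (u + Rp, -2p)\<close> satisfies \<open>min 1 \<zeta>\<^sub>0\<^sup>2 n(x)\<^sup>2 \<le> T x y\<close>
  and \<open>n(y) \<le> (4 + 2\<zeta>\<^sub>1\<^sup>2) n(x)\<close>; one factor \<open>n(x)\<close> cancels.
\<close>
lemma T_inf_sup:
  assumes "0 \<le> N" and N: "\<And>y. \<bar>T x y\<bar> \<le> N * n y"
  shows "n x \<le> (4 + 2 * \<zeta>1\<^sup>2) / min 1 (\<zeta>0\<^sup>2) * N"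
proof -
  define k where "k = min 1 (\<zeta>0\<^sup>2)"
  define K where "K = 4 + 2 * \<zeta>1\<^sup>2"
  have k: "0 < k" "k \<le> 1" "k \<le> \<zeta>0\<^sup>2" using \<zeta>0 by (simp_all add: k_def)
  have K: "1 \<le> K" by (simp add: K_def add_increasing2)
  obtain u p where x: "x = (u, p)" by (cases x)
  define y where "y = (u + R p, - 2 *\<^sub>R p)"
  note nonneg = semi_inner_productD(3)[OF a_semi] semi_inner_productD(3)[OF c]
  have "k * a u u \<le> 1 * a u u" "k * c p p \<le> 1 * c p p" "k * (nB p)\<^sup>2 \<le> \<zeta>0\<^sup>2 * (nB p)\<^sup>2"
    by (intro mult_right_mono nonneg k zero_le_power2)+
  then have lower: "k * (n x)\<^sup>2 \<le> T x y"
    using R_square_bounds(1)[of p] nonneg(2)[of p]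
    unfolding x y_def T_test_function n_square distrib_left by linarith
  have "(n y)\<^sup>2 \<le> K * (n x)\<^sup>2"
  proof -
    have "0 \<le> a (u - R p) (u - R p)" by (rule nonneg)
    then have "a (u + R p) (u + R p) \<le> 2 * a u u + 2 * a (R p) (R p)"
      by (simp add: a_expand)
    moreover have "(nB (- 2 *\<^sub>R p))\<^sup>2 = 4 * (nB p)\<^sup>2"
      unfolding is_seminormD(2)[OF nB] by (simp add: power_mult_distrib)
    moreover have "c (- 2 *\<^sub>R p) (- 2 *\<^sub>R p) = 4 * c p p" by (simp add: c_expand)
    ultimately have "(n y)\<^sup>2 \<le> 2 * a u u + 2 * (\<zeta>1\<^sup>2 * (nB p)\<^sup>2) + 4 * (nB p)\<^sup>2 + 4 * c p p"
      unfolding y_def n_square using R_square_bounds(2)[of p] by linarith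
    also have "\<dots> \<le> \<dots> + 2 * (a u u + \<zeta>1\<^sup>2 * a u u + \<zeta>1\<^sup>2 * c p p)"
      using nonneg by simp
    also have "\<dots> = K * (n x)\<^sup>2"
      unfolding x n_square K_def by (simp add: algebra_simps)
    finally show ?thesis .
  qed
  \<comment> \<open>As \<open>K \<ge> 1\<close>, passing from \<open>K\<close> to \<open>K\<^sup>2\<close> avoids a square root in the constant.\<close>
  also have "\<dots> \<le> K\<^sup>2 * (n x)\<^sup>2"
    by (intro mult_right_mono self_le_power K) simp_all
  finally have "(n y)\<^sup>2 \<le> (K * n x)\<^sup>2" by (simp only: power_mult_distrib)
  then have "n y \<le> K * n x"
    by (rule power2_le_imp_le) (use K n_nonneg[of x] in simp)
  then have "N * n y \<le> N * (K * n x)" using assms(1) by (rule mult_left_mono)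
  with lower N[of y] have "k * (n x)\<^sup>2 \<le> N * (K * n x)" by linarith
  then have "(k * n x) * n x \<le> (K * N) * n x" by (simp only: power2_eq_square mult_ac)
  then have "k * n x \<le> K * N \<or> n x = 0"
    using n_nonneg[of x] by (auto simp: mult_le_cancel_right)
  moreover have "0 \<le> K * N" using K assms(1) by (intro mult_nonneg_nonneg) auto
  ultimately have "k * n x \<le> K * N" by auto
  then have "n x \<le> K / k * N" using k(1) by (simp add: pos_le_divide_eq mult.commute)
  then show ?thesis by (simp only: k_def K_def)
qed

lemma T_injective:
  assumes "T x = T y"
  shows "x = y"
proof -
  have "n (x - y) \<le> (4 + 2 * \<zeta>1\<^sup>2) / min 1 (\<zeta>0\<^sup>2) * 0"
    by (rule T_inf_sup) (simp_all add: T_diff assms)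
  then have "n (x - y) = 0" using n_nonneg[of "x - y"] by simp
  then have "x - y = 0" using n unfolding is_norm_def by blast
  then show ?thesis by simp
qed

theorem well_posed: "well_posed n T"
  unfolding well_posed_def
proof (intro conjI allI ballI exI impI)
  show in_dual: "T x \<in> dual_space n" for x
    using linear_T T_bounded[of x] by (auto simp: dual_space_def)
  show "dual_norm n (T x) \<le> (2 + 2 * \<bar>\<zeta>1\<bar>) * n x" for x
    by (rule dual_norm_le[OF n _ T_bounded]) (simp add: n_nonneg)
  show "\<exists>!x. T x = F" if "F \<in> dual_space n" for F
    using solution_exists[OF that] T_injective by (metis (no_types))
  show "n x \<le> (4 + 2 * \<zeta>1\<^sup>2) / min 1 (\<zeta>0\<^sup>2) * dual_norm n F"
    if "F \<in> dual_space n" "T x = F" for F x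
    using T_inf_sup dual_norm_nonneg[OF n] dual_norm_bound[OF n] that by blast
qed

end

section \<open>Well-posedness for operators into the dual\<close>

theorem theorem3p1:
  fixes A :: "'v::{real_inner, complete_space} \<Rightarrow> ('v \<Rightarrow>\<^sub>L real)"
    and B :: "'v \<Rightarrow> ('q::{real_inner, complete_space} \<Rightarrow>\<^sub>L real)"
    and C :: "'q \<Rightarrow> ('q \<Rightarrow>\<^sub>L real)"
    and seminorm_B :: "'q \<Rightarrow> real"
    and \<zeta>_0 \<zeta>_inf :: real
  assumes "linear A" and "linear B" and "linear C"
    and "inner_product (\<lambda>u v. A u v)"
    and "is_seminorm seminorm_B"
    and "0 < \<zeta>_0"
    and "\<And>p. ereal (\<zeta>_0 * seminorm_B p) \<le> sup_quotient A B p"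
    and "\<And>p. sup_quotient A B p \<le> ereal (\<zeta>_inf * seminorm_B p)"
    and "semi_inner_product (\<lambda>p q. C p q)"
    and "is_norm (triple_norm A seminorm_B C)"
    and "generates_topology (form_norm A)" and "complete_wrt (form_norm A)"
    and "generates_topology (Q_norm seminorm_B C)" and "complete_wrt (Q_norm seminorm_B C)"
  shows "well_posed (triple_norm A seminorm_B C) (saddle_op A B C)"
proof -
  define a where "a u v = A u v" for u v
  define b where "b v p = B v p" for v p
  define c where "c p q = C p q" for p q
  have a: "inner_product a" and a_semi: "semi_inner_product a" and c: "semi_inner_product c"
    using assms(4,9) by (simp_all add: a_def[abs_def] c_def[abs_def] inner_product_def)
  have norm_A: "form_norm A = energy_norm a" and norm_C: "form_norm C = energy_norm c"
    by (auto simp: form_norm_def energy_norm_def a_def c_def)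
  have norm: "triple_norm A seminorm_B C = (\<lambda>(u, p). sqrt (a u u + (seminorm_B p)\<^sup>2 + c p p))"
    unfolding triple_norm_def norm_A norm_C energy_norm_square[OF a_semi] energy_norm_square[OF c] ..
  have op: "saddle_op A B C = (\<lambda>(u, p) (v, q). a u v + b v p + b u q - c p q)"
    by (simp add: saddle_op_def a_def b_def c_def add_diff_eq)
  have norm_Q: "Q_norm seminorm_B C
      = (\<lambda>p. (\<lambda>(u, p). sqrt (a u u + (seminorm_B p)\<^sup>2 + c p p)) (0, p))"
    unfolding Q_norm_def norm_C energy_norm_square[OF c]
    by (simp add: bilinear_lzero[OF semi_inner_productD(1)[OF a_semi]])
  have b: "bilinear b"
    unfolding bilinear_def b_def
    by (intro conjI allI linearI)
       (simp_all add: linear_add[OF assms(2)] linear_scale[OF assms(2)] blinfun.bilinear_simps)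
  have quotient_le: "b v p \<le> \<zeta>_inf * seminorm_B p * energy_norm a v" for v p
  proof (cases "v = 0")
    case True
    then show ?thesis
      by (simp add: energy_norm_def bilinear_lzero[OF b]
          bilinear_lzero[OF semi_inner_productD(1)[OF a_semi]])
  next
    case False
    then have "ereal (b v p / energy_norm a v) \<le> sup_quotient A B p"
      unfolding sup_quotient_def b_def norm_A by (intro Sup_upper) blast
    then have "b v p / energy_norm a v \<le> \<zeta>_inf * seminorm_B p"
      using assms(8) by (metis ereal_less_eq(3) order_trans)
    moreover have "0 < energy_norm a v"
      using is_norm_energy_norm[OF a] False energy_norm_nonneg[OF a_semi, of v]
      unfolding is_norm_def by force
    ultimately show ?thesis by (simp add: pos_divide_le_eq)
  qed
  \<comment> \<open>The supremum bounds \<open>b(v,p)\<close> without absolute value; replacing \<open>v\<close> by \<open>-v\<close> gives the rest.\<close>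
  have b_bounded: "\<bar>b v p\<bar> \<le> \<zeta>_inf * seminorm_B p * energy_norm a v" for v p
    using quotient_le[of v p] quotient_le[of "- v" p]
      is_seminormD(4)[OF is_seminorm_energy_norm[OF a_semi], of v]
    by (simp add: bilinear_lneg[OF b])
  have inf_sup: "\<zeta>_0 * seminorm_B p \<le> t"
    if t: "0 \<le> t" and le: "\<And>v. b v p \<le> t * energy_norm a v" for p t
  proof -
    have "sup_quotient A B p \<le> ereal t"
      unfolding sup_quotient_def norm_A
    proof (rule Sup_least)
      fix r assume "r \<in> insert 0 {ereal (B v p / energy_norm a v) |v. v \<noteq> 0}"
      then consider "r = 0" | v where "r = ereal (b v p / energy_norm a v)"
        by (auto simp: b_def)
      then show "r \<le> ereal t"
      proof cases
        case 2
        then show ?thesis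
          using le[of v] t energy_norm_nonneg[OF a_semi, of v]
          by (cases "energy_norm a v = 0") (auto simp: pos_divide_le_eq)
      qed (simp add: t)
    qed
    then show ?thesis using assms(7) by (metis ereal_less_eq(3) order_trans)
  qed
  interpret saddle_point a b c seminorm_B \<zeta>_0 \<zeta>_inf
    "\<lambda>(u, p). sqrt (a u u + (seminorm_B p)\<^sup>2 + c p p)"
    "\<lambda>(u, p) (v, q). a u v + b v p + b u q - c p q"
    using a b c assms(5,6,10,12,14) b_bounded inf_sup
    by unfold_locales (simp_all only: norm norm_A norm_Q)
  show ?thesis unfolding norm op by (rule well_posed)
qed

end
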